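(* Let $d \ge 2$ and let $B = \{\pm e_i : i \in \{1,\dots,d\}\} \subseteq \mathbb{Z}^d$, where $e_1,\dots,e_d$ is the standard basis. Then there is $K \in \mathbb{N}$ such that the following holds. For every finite set $A \subseteq \mathbb{Z}^d$ with $|A| = n \ge K$ and every real $\varepsilon$ with $K n^{-1/(2d)} < \varepsilon < K^{-1}$, if $$\partial_{e,G_B}(A) \le 2d\, n^{1-1/d}(1+\varepsilon),$$ then there exists $v \in \mathbb{Z}^d$ with $$|A \bigtriangleup (v + [B]_n)| < K n \sqrt{\varepsilon}.$$
   Context: $\bigtriangleup$ denotes symmetric difference. For $B \subseteq \mathbb{Z}^d$, $G_B$ is the Cayley digraph with vertex set $\mathbb{Z}^d$ and directed edges $\{(u,w) : w-u \in B\}$. For $A \subseteq \mathbb{Z}^d$, the edge boundary $\partial_{e,G_B}(A)$ is the number of directed edges $(x,y)$ of $G_B$ with $x \in A$ and $y \in \mathbb{Z}^d \setminus A$. For a finite set $S \subseteq \mathbb{Z}^d$, $C(S) \subseteq \mathbb{R}^d$ is the convex hull of $S \cup \{0\}$; for $n \in \mathbb{N}$, $\kappa_S(n) = \min\{k \in \mathbb{N} : |kC(S) \cap \mathbb{Z}^d| \ge n\}$, where $kC(S) = \{kx : x \in C(S)\}$, and $S_n = (\kappa_S(n) C(S)) \cap \mathbb{Z}^d$. Further, $[B] = \{\sum_{b \in B'} b : B' \subseteq B\}$ is the set of subset sums of $B$ (the empty sum being $0$), and $[B]_n$ denotes $S_n$ with $S = [B]$. For the set $B$ of this theorem, $C([B])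 = [-1,1]^d$. *)

theory Defs
  imports "HOL-Analysis.Analysis"
begin

text \<open>The lattice \<open>\<int>\<^sup>d\<close> is the type \<open>int ^ 'n\<close>, with \<open>d = CARD('n)\<close>.\<close>

definition lattice_vec :: "int ^ 'n \<Rightarrow> real ^ 'n" where
  "lattice_vec z = (\<chi> i. real_of_int (z $ i))"

definition cayley_arcs :: "(int ^ 'n) set \<Rightarrow> ((int ^ 'n) \<times> (int ^ 'n)) set" where
  "cayley_arcs B = {(u, w). w - u \<in> B}"

text \<open>The cardinality below is meaningful only for a finite set of arcs, in particular whenever
  \<open>A\<close> and \<open>B\<close> are finite.\<close>

definition edge_boundary :: "(int ^ 'n) set \<Rightarrow> (int ^ 'n) set \<Rightarrow> nat" where
  "edge_boundary B A = card {(x, y) \<in> cayley_arcs B. x \<in> A \<and> y \<notin> A}"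

definition hull0 :: "(int ^ 'n) set \<Rightarrow> (real ^ 'n) set" where
  "hull0 S = convex hull (lattice_vec ` (S \<union> {0}))"

definition dilate_points :: "(int ^ 'n) set \<Rightarrow> nat \<Rightarrow> (int ^ 'n) set" where
  "dilate_points S k = {z. lattice_vec z \<in> (\<lambda>x. real k *\<^sub>R x) ` hull0 S}"

text \<open>The minimum ranges over \<open>k \<ge> 0\<close>. Since the dilate by \<open>0\<close> is a single point, whether \<open>k = 0\<close> is
  admitted matters only for \<open>n \<le> 1\<close>.\<close>

definition kappa :: "(int ^ 'n) set \<Rightarrow> nat \<Rightarrow> nat" where
  "kappa S n = (LEAST k. card (dilate_points S k) \<ge> n)"

definition hull_points :: "(int ^ 'n) set \<Rightarrow> nat \<Rightarrow> (int ^ 'n) set" where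
  "hull_points S n = dilate_points S (kappa S n)"

definition subset_sums :: "(int ^ 'n) set \<Rightarrow> (int ^ 'n) set" where
  "subset_sums B = {\<Sum>b\<in>B'. b | B'. B' \<subseteq> B}"

definition signed_basis :: "(int ^ 'n) set" where
  "signed_basis = {axis i 1 | i. True} \<union> {- axis i 1 | i. True}"

end

theory Submission
  imports Defs
begin

text \<open>
Write \<open>B\<^sub>i\<close> for the size of the projection of \<open>A\<close> along \<open>e\<^sub>i\<close>. Each line meeting \<open>A\<close> contributes at least
two boundary arcs, and at least three if it does not meet \<open>A\<close> in an interval, so
\<open>2 \<Sum> B\<^sub>i + #{non-interval lines}\<close> is at most the boundary, while the Loomis--Whitney inequality and
AM--GM give \<open>\<Sum> B\<^sub>i \<ge> d n\<^bsup>1-1/d\<^esup>\<close>. Near-equality therefore forces all \<open>B\<^sub>i\<close> to be close to \<open>n\<^bsup>1-1/d\<^esup>\<close>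
and almost all lines to meet \<open>A\<close> in intervals. The inductive proof of Loomis--Whitney bounds every
slice \<open>x\<^sub>i = t\<close> by \<open>B\<^sub>i\<close>; near-equality forces all but \<open>O(\<surd>\<epsilon> n)\<close> points of \<open>A\<close> into slices of size at
least \<open>(1 - \<surd>\<epsilon>) B\<^sub>i\<close>. There are about \<open>n / B\<^sub>i \<approx> n\<^bsup>1/d\<^esup>\<close> such slices, and averaging over the lines in
direction \<open>i\<close> shows that some interval fibre nearly equals the set of their levels \<open>t\<close>. Hence all but
\<open>O(\<surd>\<epsilon> n)\<close> points of \<open>A\<close> lie in a cube of side \<open>(1 + O(\<surd>\<epsilon>)) n\<^bsup>1/d\<^esup>\<close>. The bound
\<open>\<epsilon> > K n\<^bsup>-1/(2d)\<^esup>\<close> absorbs all rounding errors.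
\<close>

subsection \<open>The Loomis--Whitney inequality\<close>

text \<open>AM--GM raised to the power \<open>card S\<close>, so that it can be applied without
  fractional exponents.\<close>

lemma prod_le_mean_power:
  fixes x :: "'a \<Rightarrow> real"
  assumes "finite S" "S \<noteq> {}" and x: "\<And>i. i \<in> S \<Longrightarrow> x i \<ge> 0"
  shows "(\<Prod>i\<in>S. x i) \<le> ((\<Sum>i\<in>S. x i) / card S) ^ card S"
proof -
  have c: "card S > 0" using assms by (simp add: card_gt_0_iff)
  have p0: "(\<Prod>i\<in>S. x i) \<ge> 0" using x by (simp add: prod_nonneg)
  have "(\<Prod>i\<in>S. x i) = ((\<Prod>i\<in>S. x i) powr (1 / card S)) ^ card S"
    using p0 c by (cases "(\<Prod>i\<in>S. x i) = 0") (auto simp: powr_power)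
  also have "\<dots> \<le> ((\<Sum>i\<in>S. x i) / card S) ^ card S"
    using arith_geom_mean[OF assms(1,2) x] by (intro power_mono) (auto simp: sum_divide_distrib)
  finally show ?thesis .
qed

text \<open>The projection along \<open>i\<close> zeroes the coordinate instead of dropping it, so
  all sets stay in one type and the induction can run over sets of coordinates.\<close>

definition forget :: "'n \<Rightarrow> int ^ 'n \<Rightarrow> int ^ 'n" where
  "forget i x = (\<chi> j. if j = i then 0 else x $ j)"

definition slice :: "(int ^ 'n) set \<Rightarrow> 'n \<Rightarrow> int \<Rightarrow> (int ^ 'n) set" where
  "slice A i t = {x \<in> A. x $ i = t}"

text \<open>For \<open>y\<close> in the image of \<open>forget i\<close>, these are the
  \<open>i\<close>-th coordinates of the points of \<open>A\<close> on the line through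
  \<open>y\<close> in direction \<open>i\<close>.\<close>

definition fibre :: "(int ^ 'n) set \<Rightarrow> 'n \<Rightarrow> int ^ 'n \<Rightarrow> int set" where
  "fibre A i y = {t. y + axis i t \<in> A}"

lemma forget_nth [simp]: "forget i x $ j = (if j = i then 0 else x $ j)"
  by (simp add: forget_def)

lemma forget_add_axis [simp]: "forget i x + axis i (x $ i) = x"
  by (simp add: vec_eq_iff axis_def)

lemma finite_slice [simp]: "finite A \<Longrightarrow> finite (slice A i t)"
  by (simp add: slice_def)

lemma sum_over_slices:
  fixes w :: "int \<Rightarrow> real"
  assumes "finite A"
  shows "(\<Sum>x\<in>A. w (x $ i)) = (\<Sum>t\<in>(\<lambda>x. x $ i) ` A. card (slice A i t) * w t)"
  by (subst sum.image_gen[OF assms, of _ "\<lambda>x. x $ i"]) (simp add: slice_def)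

text \<open>Since \<open>i \<noteq> j\<close>, \<open>forget j\<close> preserves coordinate
  \<open>i\<close>, so distinct slices have disjoint projections.\<close>

lemma card_forget_slices:
  assumes "finite A" "i \<noteq> j"
  shows "card (forget j ` A) = (\<Sum>t\<in>(\<lambda>x. x $ i) ` A. card (forget j ` slice A i t))"
proof -
  have "card (forget j ` A)
      = (\<Sum>t\<in>(\<lambda>x. x $ i) ` forget j ` A. card {y \<in> forget j ` A. y $ i = t})"
    using sum.image_gen[of "forget j ` A" "\<lambda>_. 1::nat" "\<lambda>x. x $ i"] assms by simp
  also have "(\<lambda>x. x $ i) ` forget j ` A = (\<lambda>x. x $ i) ` A"
    using assms by (simp add: image_image)
  also have "(\<lambda>t. {y \<in> forget j ` A. y $ i = t}) = (\<lambda>t. forget j ` slice A i t)"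
    using assms by (auto simp: slice_def)
  finally show ?thesis .
qed

lemma card_slice_le_forget:
  assumes "finite A"
  shows "card (slice A i t) \<le> card (forget i ` A)"
proof -
  have "inj_on (forget i) (slice A i t)"
    by (rule inj_onI) (metis (mono_tags, lifting) forget_add_axis mem_Collect_eq slice_def)
  then have "card (slice A i t) = card (forget i ` slice A i t)" by (simp add: card_image)
  also have "\<dots> \<le> card (forget i ` A)"
    using assms by (intro card_mono) (auto simp: slice_def)
  finally show ?thesis .
qed

text \<open>
With \<open>\<delta> = 0\<close> this is the induction step of the Loomis--Whitney inequality. Hoelder's inequality is
replaced by AM--GM for the ratios \<open>b\<^sub>j(t) / B\<^sub>j\<close> of the projections of the slice to those of \<open>A\<close>: their
means \<open>s t\<close> over \<open>j\<close> sum to 1.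
\<close>

lemma card_thin_slices_bound:
  fixes A :: "(int ^ 'n) set" and \<delta> :: real
  assumes fin: "finite A" "finite I" and I: "I \<noteq> {}" "i \<notin> I" and A: "A \<noteq> {}"
    and \<delta>: "0 \<le> \<delta>" "\<delta> \<le> 1"
    and LW: "\<And>t. card (slice A i t) ^ card I \<le> card (slice A i t) * (\<Prod>j\<in>I. card (forget j ` slice A i t))"
  shows "card A + \<delta> / card I * card {x \<in> A. card (slice A i (x $ i)) < (1 - \<delta>) * card (forget i ` A)}
     \<le> root (card I) (\<Prod>j\<in>insert i I. real (card (forget j ` A)))"
proof -
  define k where "k = card I"
  have k: "k > 0" using fin I by (simp add: k_def card_gt_0_iff)
  define N where "N = real (card (forget i ` A))"
  define B where "B j = real (card (forget j ` A))" for j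
  define P where "P = (\<Prod>j\<in>I. B j)"
  define a where "a t = real (card (slice A i t))" for t
  define b where "b j t = real (card (forget j ` slice A i t))" for j t
  define s where "s t = (\<Sum>j\<in>I. b j t / B j) / k" for t
  define Z where "Z = (\<lambda>x. x $ i) ` A"
  \<comment> \<open>The weight favours points in thin slices; its sum over \<open>A\<close> is the
    left-hand side of the claim.\<close>
  define w where "w t = 1 + \<delta> / k * of_bool (a t < (1 - \<delta>) * N)" for t
  have B0: "B j > 0" for j using fin A by (simp add: B_def card_gt_0_iff)
  have N0: "N > 0" using B0 by (simp add: N_def B_def)
  have P0: "P > 0" unfolding P_def by (simp add: B0 prod_pos)
  have a0: "a t \<ge> 0" for t by (simp add: a_def)
  have s0: "s t \<ge> 0" for t
    unfolding s_def by (intro divide_nonneg_nonneg sum_nonneg) (auto simp: B_def b_def)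
  have sum_s: "(\<Sum>t\<in>Z. s t) = 1"
  proof -
    have "(\<Sum>t\<in>Z. \<Sum>j\<in>I. b j t / B j) = (\<Sum>j\<in>I. (\<Sum>t\<in>Z. b j t) / B j)"
      by (subst sum.swap) (simp add: sum_divide_distrib)
    also have "\<dots> = (\<Sum>j\<in>I. 1)"
    proof (rule sum.cong)
      fix j assume "j \<in> I"
      then have "i \<noteq> j" using I by auto
      then have "(\<Sum>t\<in>Z. b j t) = B j"
        using card_forget_slices[OF fin(1), of i j] by (simp add: b_def B_def Z_def)
      then show "(\<Sum>t\<in>Z. b j t) / B j = 1" using B0[of j] by simp
    qed simp
    finally have "(\<Sum>t\<in>Z. \<Sum>j\<in>I. b j t / B j) / k = 1" using fin I(1) by (simp add: k_def)
    then show ?thesis by (simp only: s_def sum_divide_distrib)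
  qed
  have ak: "a t ^ k \<le> a t * P * s t ^ k" for t
  proof -
    have "a t ^ k \<le> a t * (\<Prod>j\<in>I. b j t)"
      using LW[of t] unfolding a_def b_def k_def
      by (simp only: of_nat_prod[symmetric] of_nat_power[symmetric] of_nat_mult[symmetric] of_nat_le_iff)
    also have "(\<Prod>j\<in>I. b j t) = P * (\<Prod>j\<in>I. b j t / B j)"
      unfolding prod_dividef P_def[symmetric] using P0 by simp
    also have "(\<Prod>j\<in>I. b j t / B j) \<le> s t ^ k"
      unfolding s_def k_def using fin I B0
      by (intro prod_le_mean_power) (auto simp: b_def less_imp_le)
    finally show ?thesis using P0 a0 by (simp add: mult.assoc mult_left_mono)
  qed
  \<comment> \<open>The bound \<open>ak\<close> leaves one factor \<open>a t\<close> on its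
    right-hand side; \<open>a t * w t ^ k \<le> N\<close> shows that this factor has room for the
    weight.\<close>
  have aw: "a t * w t \<le> root k (N * P) * s t" for t
  proof (rule power_le_imp_le_base)
    have aN: "a t \<le> N" using card_slice_le_forget[OF fin(1)] by (simp add: a_def N_def)
    have w0: "w t \<ge> 0" using \<delta> by (simp add: w_def)
    have "a t * w t ^ k \<le> N"
    proof (cases "a t < (1 - \<delta>) * N")
      case True
      have "w t ^ k = (1 + \<delta> / k) ^ k" using True by (simp add: w_def)
      \<comment> \<open>The factor \<open>exp \<delta>\<close> is cancelled by the factor
        \<open>1 - \<delta> \<le> exp (- \<delta>)\<close> that a thin slice loses against
        \<open>N\<close>.\<close>
      also have "\<dots> \<le> exp \<delta>"
        using k \<delta> by (intro exp_ge_one_plus_x_over_n_power_n) auto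
      finally have "a t * w t ^ k \<le> ((1 - \<delta>) * N) * exp \<delta>"
        using True a0[of t] w0 by (intro mult_mono) auto
      also have "\<dots> = N * ((1 - \<delta>) * exp \<delta>)" by simp
      also have "\<dots> \<le> N * (exp (- \<delta>) * exp \<delta>)"
        using N0 exp_ge_add_one_self[of "- \<delta>"] by (intro mult_left_mono mult_right_mono) auto
      finally show ?thesis by (simp flip: exp_add)
    qed (simp add: w_def aN)
    then have *: "a t * w t ^ k * (P * s t ^ k) \<le> N * (P * s t ^ k)"
      using P0 s0 by (intro mult_right_mono) auto
    have "(a t * w t) ^ k \<le> (a t * P * s t ^ k) * w t ^ k"
      using ak[of t] w0 by (simp add: power_mult_distrib mult_right_mono)
    also have "\<dots> \<le> (root k (N * P) * s t) ^ k"
      using * k N0 P0 by (simp add: power_mult_distrib algebra_simps)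
    finally show "(a t * w t) ^ Suc (k - 1) \<le> (root k (N * P) * s t) ^ Suc (k - 1)"
      using k by simp
    show "0 \<le> root k (N * P) * s t"
      using s0 N0 P0 k by (intro mult_nonneg_nonneg real_root_ge_zero) auto
  qed
  have "real (card {x \<in> A. a (x $ i) < (1 - \<delta>) * N}) = (\<Sum>x\<in>A. of_bool (a (x $ i) < (1 - \<delta>) * N))"
    using fin(1) by (simp add: of_bool_def flip: sum.inter_filter)
  then have "card A + \<delta> / k * card {x \<in> A. a (x $ i) < (1 - \<delta>) * N} = (\<Sum>x\<in>A. w (x $ i))"
    unfolding w_def by (simp only: sum.distrib sum_distrib_left) simp
  also have "\<dots> = (\<Sum>t\<in>Z. a t * w t)"
    using sum_over_slices[OF fin(1)] by (simp add: Z_def a_def)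
  also have "\<dots> \<le> (\<Sum>t\<in>Z. root k (N * P) * s t)" by (intro sum_mono aw)
  also have "\<dots> = root k (N * P)" using sum_s by (simp flip: sum_distrib_left)
  also have "N * P = (\<Prod>j\<in>insert i I. B j)"
    using fin I by (simp add: P_def N_def B_def)
  finally show ?thesis by (simp add: a_def N_def B_def k_def)
qed

text \<open>Induction over the set \<open>I\<close> of coordinates that may vary on
  \<open>A\<close>: slicing at \<open>i\<close> fixes that coordinate too. The extra factor
  \<open>card A\<close> on both sides makes the bound valid for empty slices and avoids the exponent
  \<open>card I - 1\<close>.\<close>

lemma Loomis_Whitney:
  fixes A :: "(int ^ 'n) set"
  assumes "finite I" "I \<noteq> {}" "finite A"
    and "\<And>x y j. x \<in> A \<Longrightarrow> y \<in> A \<Longrightarrow> j \<notin> I \<Longrightarrow> x $ j = y $ j"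
  shows "card A ^ card I \<le> card A * (\<Prod>j\<in>I. card (forget j ` A))"
  using assms
proof (induction I arbitrary: A rule: finite_ne_induct)
  case (singleton j)
  then show ?case by (cases "A = {}") (auto simp: Suc_le_eq card_gt_0_iff)
next
  case (insert i I)
  show ?case
  proof (cases "A = {}")
    case True
    have "card (insert i I) = Suc (card I)" using insert.hyps(1,3) by simp
    then show ?thesis by (simp only: True card.empty power_Suc mult_0 le0)
  next
    case False
    have "card (slice A i t) ^ card I \<le> card (slice A i t) * (\<Prod>j\<in>I. card (forget j ` slice A i t))" for t
    proof (rule insert.IH)
      fix x y j assume xy: "x \<in> slice A i t" "y \<in> slice A i t" and "j \<notin> I"
      then show "x $ j = y $ j"
        using insert.prems(2)[of x y j] by (cases "j = i") (auto simp: slice_def)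
    qed (use insert.prems(1) in simp)
    then have "real (card A) \<le> root (card I) (\<Prod>j\<in>insert i I. real (card (forget j ` A)))"
      using card_thin_slices_bound[OF insert.prems(1) insert.hyps(1-3) False, of 0] by simp
    moreover have "card I > 0" using insert.hyps by (simp add: card_gt_0_iff)
    ultimately have "real (card A) ^ card I \<le> (\<Prod>j\<in>insert i I. real (card (forget j ` A)))"
      using power_mono[of "real (card A)" "root (card I) (\<Prod>j\<in>insert i I. real (card (forget j ` A)))" "card I"]
      by (simp only: real_root_pow_pos2 prod_nonneg of_nat_0_le_iff simp_thms)
    then have "card A ^ card I \<le> (\<Prod>j\<in>insert i I. card (forget j ` A))"
      by (simp only: of_nat_prod[symmetric] of_nat_power[symmetric] of_nat_le_iff)
    then have "card A * card A ^ card I \<le> card A * (\<Prod>j\<in>insert i I. card (forget j ` A))"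
      by (rule mult_left_mono) simp
    then show ?thesis using insert.hyps(1,3) by (metis card_insert_disjoint power_Suc)
  qed
qed

subsection \<open>Fibres and the edge boundary\<close>

lemma finite_fibre [simp]:
  assumes "finite A"
  shows "finite (fibre A i y)"
proof -
  have "inj_on (\<lambda>t. y + axis i t) (fibre A i y)"
    by (auto intro!: inj_onI simp: axis_eq_axis)
  moreover have "(\<lambda>t. y + axis i t) ` fibre A i y \<subseteq> A" by (auto simp: fibre_def)
  ultimately show ?thesis using assms finite_imageD finite_subset by blast
qed

text \<open>The lines in direction \<open>i\<close> partition \<open>A\<close>. The arbitrary
  predicate lets one count serve boundary points as well as prescribed levels.\<close>

lemma card_filter_eq_sum_fibre:
  fixes A :: "(int ^ 'n) set"
  assumes "finite A"
  shows "card {x \<in> A. P x} = (\<Sum>y\<in>forget i ` A. card {t \<in> fibre A i y. P (y + axis i t)})"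
proof -
  have "forget i ` {x \<in> A. P x} \<subseteq> forget i ` A" by auto
  then have "card {x \<in> A. P x} = (\<Sum>y\<in>forget i ` A. card {x \<in> {x \<in> A. P x}. forget i x = y})"
    using sum.group[of "{x \<in> A. P x}" "forget i ` A" "forget i" "\<lambda>_. 1::nat"] assms by simp
  also have "\<dots> = (\<Sum>y\<in>forget i ` A. card {t \<in> fibre A i y. P (y + axis i t)})"
  proof (rule sum.cong[OF refl bij_betw_same_card])
    fix y assume "y \<in> forget i ` A"
    then have "y $ i = 0" by auto
    then have "forget i (y + axis i t) = y" "(y + axis i t) $ i = t" for t
      by (auto simp: vec_eq_iff axis_def)
    then show "bij_betw (\<lambda>x. x $ i) {x \<in> {x \<in> A. P x}. forget i x = y}
        {t \<in> fibre A i y. P (y + axis i t)}"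
      by (intro bij_betw_byWitness[where f' = "\<lambda>t. y + axis i t"]) (auto simp: fibre_def)
  qed
  finally show ?thesis .
qed

lemma fibre_nonempty:
  assumes "y \<in> forget i ` A"
  shows "fibre A i y \<noteq> {}"
proof -
  from assms obtain x where "x \<in> A" "y = forget i x" by auto
  then have "x $ i \<in> fibre A i y" by (simp add: fibre_def)
  then show ?thesis by auto
qed

section \<open>Ends of finite sets of integers\<close>

lemma Max_in_right_end:
  fixes F :: "int set"
  assumes "finite F" "F \<noteq> {}"
  shows "Max F \<in> {t \<in> F. t + 1 \<notin> F}"
  using assms Max_ge[of F "Max F + 1"] by auto

lemma Min_in_left_end:
  fixes F :: "int set"
  assumes "finite F" "F \<noteq> {}"
  shows "Min F \<in> {t \<in> F. t - 1 \<notin> F}"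
  using assms Min_le[of F "Min F - 1"] by auto

text \<open>An upward walk from \<open>Min F\<close> can leave \<open>F\<close> only after a right
  end, hence only after \<open>Max F\<close>.\<close>

lemma interval_if_unique_right_end:
  fixes F :: "int set"
  assumes F: "finite F" "F \<noteq> {}" and uniq: "\<And>t. t \<in> F \<Longrightarrow> t + 1 \<notin> F \<Longrightarrow> t = Max F"
  shows "F = {Min F..Max F}"
proof -
  have "t \<le> Max F \<longrightarrow> t \<in> F" if "Min F \<le> t" for t
    using that
  proof (induction t rule: int_ge_induct)
    case (step t)
    then show ?case using uniq[of t] by (cases "t + 1 \<in> F") auto
  qed (use F in simp)
  then show ?thesis using F Min_le[OF F(1)] Max_ge[OF F(1)] by (intro set_eqI) (metis atLeastAtMost_iff)
qed

text \<open>\<open>Max F\<close> is always a right end, and a gap in \<open>F\<close> forces a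
  second one.\<close>

lemma card_right_ends:
  fixes F :: "int set"
  assumes F: "finite F" "F \<noteq> {}"
  shows "1 + of_bool (F \<noteq> {Min F..Max F}) \<le> card {t \<in> F. t + 1 \<notin> F}"
proof (cases "F \<noteq> {Min F..Max F}")
  case False
  have "card {Max F} \<le> card {t \<in> F. t + 1 \<notin> F}"
    using Max_in_right_end[OF F] F by (intro card_mono) auto
  then show ?thesis unfolding of_bool_def if_not_P[OF False] by simp
next
  case True
  with interval_if_unique_right_end[OF F] obtain t where t: "t \<in> F" "t + 1 \<notin> F" "t \<noteq> Max F" by blast
  then have "card {t, Max F} \<le> card {t \<in> F. t + 1 \<notin> F}"
    using Max_in_right_end[OF F] F by (intro card_mono) auto
  moreover have "card {t, Max F} = 2" using t by simp
  ultimately show ?thesis unfolding of_bool_def if_P[OF True] by simp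
qed

lemma card_left_ends:
  fixes F :: "int set"
  assumes F: "finite F" "F \<noteq> {}"
  shows "1 \<le> card {t \<in> F. t - 1 \<notin> F}"
proof -
  have "card {Min F} \<le> card {t \<in> F. t - 1 \<notin> F}"
    using Min_in_left_end[OF F] F by (intro card_mono) auto
  then show ?thesis by simp
qed

text \<open>For finite \<open>A\<close> these fibres are finite and nonempty, so comparison with the
  span from \<open>Min\<close> to \<open>Max\<close> tests for being an interval.\<close>

definition gappy :: "(int ^ 'n) set \<Rightarrow> 'n \<Rightarrow> (int ^ 'n) set" where
  "gappy A i = {y \<in> forget i ` A. fibre A i y \<noteq> {Min (fibre A i y)..Max (fibre A i y)}}"

lemma axis_add: "axis i (a + b) = axis i a + (axis i b :: 'a::monoid_add ^ 'n)"
  by (simp add: vec_eq_iff axis_def)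

text \<open>Gaps are charged to right ends only; one surplus arc per gappy line suffices
  later.\<close>

lemma card_right_boundary:
  fixes A :: "(int ^ 'n) set"
  assumes A: "finite A"
  shows "card (forget i ` A) + card (gappy A i) \<le> card {x \<in> A. x + axis i 1 \<notin> A}"
proof -
  have "card (forget i ` A) + card (gappy A i)
      = (\<Sum>y\<in>forget i ` A. 1 + of_bool (fibre A i y \<noteq> {Min (fibre A i y)..Max (fibre A i y)}))"
    using A by (simp only: sum.distrib) (simp add: gappy_def of_bool_def flip: sum.inter_filter)
  also have "\<dots> \<le> (\<Sum>y\<in>forget i ` A. card {t \<in> fibre A i y. t + 1 \<notin> fibre A i y})"
    using A by (intro sum_mono card_right_ends) (auto simp: fibre_nonempty)
  also have "\<dots> = card {x \<in> A. x + axis i 1 \<notin> A}"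
    using A by (simp add: card_filter_eq_sum_fibre[of A _ i] fibre_def axis_add add.assoc)
  finally show ?thesis .
qed

lemma card_left_boundary:
  fixes A :: "(int ^ 'n) set"
  assumes A: "finite A"
  shows "card (forget i ` A) \<le> card {x \<in> A. x - axis i 1 \<notin> A}"
proof -
  have "y + axis i t - axis i 1 = (y + axis i (t - 1) :: int ^ 'n)" for y t
    by (simp add: vec_eq_iff axis_def)
  then have "card {t \<in> fibre A i y. y + axis i t - axis i 1 \<notin> A}
      = card {t \<in> fibre A i y. t - 1 \<notin> fibre A i y}" for y
    by (simp only: fibre_def mem_Collect_eq)
  then have "card {x \<in> A. x - axis i 1 \<notin> A}
      = (\<Sum>y\<in>forget i ` A. card {t \<in> fibre A i y. t - 1 \<notin> fibre A i y})"
    by (simp only: card_filter_eq_sum_fibre[OF A, of _ i])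
  moreover have "(\<Sum>y\<in>forget i ` A. 1) \<le> (\<Sum>y\<in>forget i ` A. card {t \<in> fibre A i y. t - 1 \<notin> fibre A i y})"
    using A by (intro sum_mono card_left_ends) (auto simp: fibre_nonempty)
  ultimately show ?thesis by simp
qed

section \<open>The edge boundary as a sum over directions\<close>

lemma edge_boundary_eq_sum:
  assumes "finite A" "finite B"
  shows "edge_boundary B A = (\<Sum>b\<in>B. card {x \<in> A. x + b \<notin> A})"
proof -
  have "bij_betw (\<lambda>(b, x). (x, x + b)) (SIGMA b:B. {x \<in> A. x + b \<notin> A})
      {(x, y) \<in> cayley_arcs B. x \<in> A \<and> y \<notin> A}"
    by (rule bij_betw_byWitness[where f' = "\<lambda>(x, y). (y - x, x)"])
      (auto simp: cayley_arcs_def)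
  then show ?thesis
    using assms by (simp add: edge_boundary_def flip: bij_betw_same_card)
qed

lemma edge_boundary_signed_basis:
  fixes A :: "(int ^ 'n::finite) set"
  assumes A: "finite A"
  shows "edge_boundary signed_basis A
    = (\<Sum>i\<in>UNIV. card {x \<in> A. x + axis i 1 \<notin> A} + card {x \<in> A. x - axis i 1 \<notin> A})"
proof -
  let ?c = "\<lambda>b. card {x \<in> A. x + b \<notin> A}"
  have sb: "signed_basis = range (\<lambda>i. axis i (1::int) :: int ^ 'n) \<union> range (\<lambda>i. - axis i 1)"
    by (auto simp: signed_basis_def)
  have inj: "inj (\<lambda>i. axis i (1::int) :: int ^ 'n)" "inj (\<lambda>i. - axis i (1::int) :: int ^ 'n)"
    by (auto intro!: injI simp: axis_eq_axis)
  have disj: "range (\<lambda>i. axis i (1::int) :: int ^ 'n) \<inter> range (\<lambda>i. - axis i 1) = {}"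
  proof (rule ccontr)
    assume "\<not> ?thesis"
    then obtain i j where "axis i (1::int) = - (axis j 1 :: int ^ 'n)" by auto
    from arg_cong[OF this, of "\<lambda>x. x $ i"] show False by (simp add: axis_def split: if_splits)
  qed
  have "edge_boundary signed_basis A = sum ?c signed_basis"
    by (rule edge_boundary_eq_sum[OF A]) (simp add: sb)
  also have "\<dots> = sum ?c (range (\<lambda>i. axis i 1)) + sum ?c (range (\<lambda>i. - axis i 1))"
    unfolding sb using disj by (intro sum.union_disjoint) auto
  finally show ?thesis by (simp add: sum.reindex inj sum.distrib)
qed

text \<open>The gappy lines of a single direction \<open>j\<close> are retained, since intervals are
  later sought one direction at a time.\<close>

lemma edge_boundary_ge:
  fixes A :: "(int ^ 'n::finite) set"
  assumes A: "finite A"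
  shows "2 * (\<Sum>i\<in>UNIV. card (forget i ` A)) + card (gappy A j) \<le> edge_boundary signed_basis A"
proof -
  have "card (gappy A j) \<le> (\<Sum>i\<in>UNIV. card (gappy A i))"
    by (rule member_le_sum[of j UNIV "\<lambda>i. card (gappy A i)"]) auto
  then have "2 * (\<Sum>i\<in>UNIV. card (forget i ` A)) + card (gappy A j)
      \<le> (\<Sum>i\<in>UNIV. (card (forget i ` A) + card (gappy A i)) + card (forget i ` A))"
    by (simp add: sum.distrib)
  also have "\<dots> \<le> edge_boundary signed_basis A"
    unfolding edge_boundary_signed_basis[OF A]
    by (intro sum_mono add_mono card_right_boundary card_left_boundary A)
  finally show ?thesis .
qed

section \<open>A good line by averaging\<close>

text \<open>The symmetric differences of \<open>T\<close> with the fibres are summed over all lines.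
  At least half of the lines meet \<open>A\<close> in intervals, so one of these has at most twice
  the average.\<close>

lemma obtain_interval_fibre:
  fixes A :: "(int ^ 'n) set" and \<delta> :: real
  assumes A: "finite A" "A \<noteq> {}" and T: "finite T"
    and thick: "\<And>t. t \<in> T \<Longrightarrow> (1 - \<delta>) * card (forget i ` A) \<le> card (slice A i t)"
    and gaps: "2 * card (gappy A i) \<le> card (forget i ` A)"
  obtains a b where
    "(card (T - {a..b}) + card ({a..b} - T)) * card (forget i ` A)
       \<le> 2 * (\<delta> * card (forget i ` A) * card T + card {x \<in> A. x $ i \<notin> T})"
proof -
  define Y where "Y = forget i ` A"
  define N where "N = real (card Y)"
  define F where "F = fibre A i"
  define Y' where "Y' = Y - gappy A i"
  define W where "W = \<delta> * N * card T + card {x \<in> A. x $ i \<notin> T}"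
  define g where "g y = real (card (T - F y)) + real (card (F y - T))" for y
  have Y: "finite Y" "Y \<noteq> {}" using A by (auto simp: Y_def)
  have F: "finite (F y)" for y using A by (simp add: F_def)
  have y0: "y $ i = 0" if "y \<in> Y" for y using that by (auto simp: Y_def)
  have N: "N > 0" using Y by (simp add: N_def card_gt_0_iff)
  have card_Y': "2 * real (card Y') \<ge> N"
  proof -
    have "card Y' = card Y - card (gappy A i)"
      unfolding Y'_def using Y by (intro card_Diff_subset) (auto simp: gappy_def Y_def)
    then show ?thesis using gaps by (simp add: N_def Y_def)
  qed
  have out: "(\<Sum>y\<in>Y. real (card (F y - T))) = card {x \<in> A. x $ i \<notin> T}"
  proof -
    have "card {x \<in> A. x $ i \<notin> T} = (\<Sum>y\<in>Y. card {t \<in> F y. (y + axis i t) $ i \<notin> T})"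
      unfolding Y_def F_def by (rule card_filter_eq_sum_fibre[OF A(1)])
    also have "\<dots> = (\<Sum>y\<in>Y. card (F y - T))"
      using y0 by (intro sum.cong refl arg_cong[of _ _ card]) auto
    finally show ?thesis by simp
  qed
  have inn: "(\<Sum>y\<in>Y. real (card (F y \<inter> T))) = (\<Sum>t\<in>T. real (card (slice A i t)))"
  proof -
    have "card {x \<in> A. x $ i \<in> T} = (\<Sum>y\<in>Y. card {t \<in> F y. (y + axis i t) $ i \<in> T})"
      unfolding Y_def F_def by (rule card_filter_eq_sum_fibre[OF A(1)])
    also have "\<dots> = (\<Sum>y\<in>Y. card (F y \<inter> T))"
      using y0 by (intro sum.cong refl arg_cong[of _ _ card]) auto
    finally have *: "card {x \<in> A. x $ i \<in> T} = (\<Sum>y\<in>Y. card (F y \<inter> T))" .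
    have "(\<lambda>x. x $ i) ` {x \<in> A. x $ i \<in> T} \<subseteq> T" by auto
    then have "card {x \<in> A. x $ i \<in> T} = (\<Sum>t\<in>T. card {x \<in> {x \<in> A. x $ i \<in> T}. x $ i = t})"
      using sum.group[of "{x \<in> A. x $ i \<in> T}" T "\<lambda>x. x $ i" "\<lambda>_. 1::nat"] A T by simp
    also have "\<dots> = (\<Sum>t\<in>T. card (slice A i t))"
      by (intro sum.cong refl arg_cong[of _ _ card]) (auto simp: slice_def)
    finally show ?thesis using * by (simp flip: of_nat_sum)
  qed
  \<comment> \<open>Double counting: a level in \<open>T\<close> is missed by at most
    \<open>\<delta> * N\<close> fibres.\<close>
  have "(\<Sum>y\<in>Y. real (card (T - F y))) = (\<Sum>y\<in>Y. real (card T) - real (card (F y \<inter> T)))"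
  proof (rule sum.cong[OF refl])
    fix y
    have "card T = card (T - F y) + card (T \<inter> F y)"
      using T by (metis add.commute card_Int_Diff)
    then show "real (card (T - F y)) = real (card T) - real (card (F y \<inter> T))"
      by (simp add: Int_commute)
  qed
  also have "\<dots> = N * card T - (\<Sum>t\<in>T. real (card (slice A i t)))"
    by (simp add: sum_subtractf inn N_def)
  also have "\<dots> \<le> N * card T - (\<Sum>t\<in>T. (1 - \<delta>) * N)"
    using thick by (intro diff_left_mono sum_mono) (auto simp: N_def Y_def)
  also have "\<dots> = \<delta> * N * card T" by (simp add: algebra_simps)
  finally have sum_g: "sum g Y \<le> W" by (simp add: g_def W_def sum.distrib out)
  \<comment> \<open>Otherwise the lines in \<open>Y'\<close>, at least \<open>N / 2\<close> of them,
    would already contribute more than \<open>W\<close> to \<open>sum g Y\<close>.\<close>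
  have "\<exists>y\<in>Y'. g y * N \<le> 2 * W"
  proof (rule ccontr)
    assume "\<not> ?thesis"
    then have less: "2 * W < g y * N" if "y \<in> Y'" for y using that by auto
    have "card Y' > 0" using card_Y' N by simp
    then have "Y' \<noteq> {}" "finite Y'" by (auto simp: card_gt_0_iff)
    then have "(\<Sum>y\<in>Y'. 2 * W) < (\<Sum>y\<in>Y'. g y * N)" using less by (intro sum_strict_mono) auto
    also have "\<dots> \<le> (\<Sum>y\<in>Y. g y * N)"
      using N Y by (intro sum_mono2) (auto simp: Y'_def g_def)
    also have "\<dots> = sum g Y * N" by (simp add: sum_distrib_right)
    also have "\<dots> \<le> W * N" using sum_g N by (simp add: mult_right_mono)
    finally have "(2 * real (card Y')) * W < N * W" by (simp add: mult_ac)
    moreover have "W \<ge> 0"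
      using sum_g sum_nonneg[of Y g] by (simp add: g_def)
    ultimately show False using card_Y' mult_right_mono[of N "2 * real (card Y')" W] by simp
  qed
  then obtain y where y: "y \<in> Y'" "g y * N \<le> 2 * W" by blast
  then have "F y = {Min (F y)..Max (F y)}" by (auto simp: Y'_def Y_def gappy_def F_def)
  with y that[of "Min (F y)" "Max (F y)"] show thesis
    by (simp add: g_def W_def N_def Y_def)
qed

subsection \<open>The cubes\<close>

text \<open>In coordinate \<open>i\<close> only \<open>axis i 1\<close> contributes \<open>1\<close>
  and only its negative contributes \<open>-1\<close>, each at most once.\<close>

lemma subset_sums_signed_basis_le:
  fixes z :: "int ^ 'n::finite"
  assumes "z \<in> subset_sums signed_basis"
  shows "\<bar>z $ i\<bar> \<le> 1"
proof -
  obtain B' where B': "B' \<subseteq> signed_basis" "z = (\<Sum>b\<in>B'. b)"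
    using assms by (auto simp: subset_sums_def)
  have "finite (signed_basis :: (int ^ 'n) set)"
    by (auto simp: signed_basis_def full_SetCompr_eq)
  then have fin: "finite B'" using B' finite_subset by blast
  have z: "z $ i = (\<Sum>b\<in>B'. b $ i)" by (simp add: B' sum_component)
  have "(\<Sum>b\<in>B'. b $ i) \<le> (\<Sum>b\<in>B'. of_bool (b = axis i 1))"
    using B' by (intro sum_mono) (auto simp: signed_basis_def axis_def)
  also have "\<dots> \<le> 1" using fin by (simp add: of_bool_def)
  finally have "z $ i \<le> 1" by (simp add: z)
  have "(\<Sum>b\<in>B'. - (b $ i)) \<le> (\<Sum>b\<in>B'. of_bool (b = - axis i 1))"
    using B' by (intro sum_mono) (auto simp: signed_basis_def axis_def)
  also have "\<dots> \<le> 1" using fin by (simp add: of_bool_def)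
  finally have "- (z $ i) \<le> 1" by (simp add: z sum_negf)
  with \<open>z $ i \<le> 1\<close> show ?thesis by simp
qed

text \<open>One of the two signed vectors is selected in each direction. Corners are enough, as
  their hull is the cube.\<close>

lemma subset_sums_signed_basis_corner:
  fixes z :: "int ^ 'n::finite"
  assumes "\<And>i. z $ i \<in> {-1, 1}"
  shows "z \<in> subset_sums signed_basis"
proof -
  let ?f = "\<lambda>i. axis i (z $ i)"
  have nz: "z $ i \<noteq> 0" for i using assms[of i] by auto
  have "inj ?f" using nz by (auto intro!: injI simp: axis_eq_axis)
  then have "(\<Sum>b\<in>range ?f. b) = (\<Sum>i\<in>UNIV. ?f i)" by (simp add: sum.reindex)
  also have "\<dots> = z" by (simp add: vec_eq_iff sum_component axis_def)
  finally have *: "z = (\<Sum>b\<in>range ?f. b)" by simp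
  have "?f i \<in> signed_basis" for i
  proof -
    have "axis i (-1) = - (axis i 1 :: int ^ 'n)" by (simp add: vec_eq_iff axis_def)
    then show ?thesis using assms[of i] by (auto simp: signed_basis_def)
  qed
  then have "range ?f \<subseteq> signed_basis" by auto
  with * show ?thesis unfolding subset_sums_def by blast
qed

text \<open>The cube is the Minkowski sum of segments along the axes, and convex hulls commute with
  Minkowski sums.\<close>

lemma cube_eq_convex_hull_corners:
  "{x :: real ^ 'n::finite. \<forall>i. x $ i \<in> {-1..1}} = convex hull {x. \<forall>i. x $ i \<in> {-1, 1}}"
proof -
  have eq: "{x :: real ^ 'n. \<forall>i\<in>Basis. x \<bullet> i \<in> S} = {x. \<forall>i. x $ i \<in> S}" for S
    by (auto simp: Basis_vec_def inner_axis)
  have interval: "convex hull {-1, 1} = cbox (-1) (1::real)"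
    by (simp add: convex_hull_eq_real_cbox)
  have "{x :: real ^ 'n. \<forall>i\<in>Basis. x \<bullet> i \<in> cbox (-1) 1} = (\<Sum>i\<in>Basis. (\<lambda>x. x *\<^sub>R i) ` cbox (-1) 1)"
    by (simp only: box_eq_set_sum_Basis)
  also have "cbox (-1) (1::real) = convex hull {-1, 1}"
    by (simp only: interval)
  also have "(\<Sum>i\<in>Basis. (\<lambda>x. x *\<^sub>R i) ` (convex hull {-1, 1}))
      = (\<Sum>i\<in>Basis. convex hull ((\<lambda>x. x *\<^sub>R (i :: real ^ 'n)) ` {-1, 1}))"
    by (simp add: convex_hull_linear_image)
  also have "\<dots> = convex hull (\<Sum>i\<in>Basis. (\<lambda>x. x *\<^sub>R i) ` {-1, 1})"
    by (simp only: convex_hull_set_sum)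
  also have "\<dots> = convex hull {x. \<forall>i\<in>Basis. x \<bullet> i \<in> {-1, 1}}"
    by (simp only: box_eq_set_sum_Basis)
  finally show ?thesis by (simp only: eq interval cbox_interval)
qed

text \<open>The generators lie in the cube, which is convex, and they include all its
  corners.\<close>

lemma hull0_subset_sums_signed_basis:
  "hull0 (subset_sums (signed_basis :: (int ^ 'n::finite) set)) = {x. \<forall>i. x $ i \<in> {-1..1}}"
proof
  show "hull0 (subset_sums signed_basis) \<subseteq> {x :: real ^ 'n. \<forall>i. x $ i \<in> {-1..1}}"
    unfolding hull0_def
  proof (rule hull_minimal)
    have "real_of_int (z $ i) \<in> {-1..1}" if "z \<in> subset_sums signed_basis" for z :: "int ^ 'n" and i
      using subset_sums_signed_basis_le[OF that, of i] by (simp add: abs_le_iff)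
    then show "lattice_vec ` (subset_sums signed_basis \<union> {0}) \<subseteq> {x :: real ^ 'n. \<forall>i. x $ i \<in> {-1..1}}"
      by (auto simp: lattice_vec_def)
    show "convex {x :: real ^ 'n. \<forall>i. x $ i \<in> {-1..1}}"
      by (simp only: cube_eq_convex_hull_corners convex_convex_hull)
  qed
  show "{x :: real ^ 'n. \<forall>i. x $ i \<in> {-1..1}} \<subseteq> hull0 (subset_sums signed_basis)"
    unfolding cube_eq_convex_hull_corners hull0_def
  proof (rule hull_mono, rule subsetI)
    fix x :: "real ^ 'n" assume "x \<in> {x. \<forall>i. x $ i \<in> {-1, 1}}"
    then have x: "x $ i = 1 \<or> x $ i = -1" for i by auto
    define z :: "int ^ 'n" where "z = (\<chi> i. if x $ i = 1 then 1 else -1)"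
    have "x = lattice_vec z" using x by (auto simp: vec_eq_iff lattice_vec_def z_def)
    moreover have "z \<in> subset_sums signed_basis"
      by (rule subset_sums_signed_basis_corner) (simp add: z_def)
    ultimately show "x \<in> lattice_vec ` (subset_sums signed_basis \<union> {0})" by blast
  qed
qed

lemma dilate_points_signed_basis:
  "dilate_points (subset_sums (signed_basis :: (int ^ 'n::finite) set)) k
    = {z. \<forall>i. z $ i \<in> {- int k..int k}}"
proof (intro set_eqI iffI)
  fix z :: "int ^ 'n"
  assume "z \<in> dilate_points (subset_sums signed_basis) k"
  then obtain x where x: "\<And>i. x $ i \<in> {-1..1}" "lattice_vec z = real k *\<^sub>R x"
    by (auto simp: dilate_points_def hull0_subset_sums_signed_basis)
  have "real_of_int (z $ i) = real k * x $ i" for i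
    using arg_cong[OF x(2), of "\<lambda>v. v $ i"] by (simp add: lattice_vec_def)
  moreover have "real k * x $ i \<le> real k * 1" "real k * (-1) \<le> real k * x $ i" for i
    using x(1)[of i] mult_left_mono[of "x $ i" 1 "real k"] mult_left_mono[of "-1" "x $ i" "real k"]
    by simp_all
  ultimately have "real_of_int (z $ i) \<le> real k" "- real k \<le> real_of_int (z $ i)" for i
    by (auto simp del: mult_le_cancel_left_pos)
  then have "z $ i \<le> int k \<and> - int k \<le> z $ i" for i
    by (metis of_int_le_iff of_int_minus of_int_of_nat_eq)
  then show "z \<in> {z. \<forall>i. z $ i \<in> {- int k..int k}}" by simp
next
  fix z :: "int ^ 'n"
  assume z: "z \<in> {z. \<forall>i. z $ i \<in> {- int k..int k}}"
  \<comment> \<open>For \<open>k = 0\<close> division by zero gives \<open>x = 0\<close>, which is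
    the right witness because then \<open>z = 0\<close>.\<close>
  define x :: "real ^ 'n" where "x = (\<chi> i. real_of_int (z $ i) / real k)"
  have le: "real_of_int (z $ i) \<le> real k" "- real k \<le> real_of_int (z $ i)" for i
    using z by (auto simp: of_int_le_iff[where 'a=real, symmetric] simp del: of_int_le_iff)
  have "x $ i \<in> {-1..1}" for i
    using le[of i] by (cases "k = 0") (auto simp: x_def field_simps)
  moreover have "lattice_vec z = real k *\<^sub>R x"
    using z by (cases "k = 0") (auto simp: vec_eq_iff lattice_vec_def x_def)
  ultimately show "z \<in> dilate_points (subset_sums signed_basis) k"
    by (auto simp: dilate_points_def hull0_subset_sums_signed_basis)
qed

section \<open>Lattice points in boxes\<close>

lemma bij_betw_vec_nth_box:
  "bij_betw vec_nth {x :: 'a ^ 'n::finite. \<forall>i. x $ i \<in> F i} (PiE UNIV F)"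
  by (rule bij_betw_byWitness[where f' = vec_lambda]) auto

lemma card_box:
  "card {x :: 'a ^ 'n::finite. \<forall>i. x $ i \<in> F i} = (\<Prod>i\<in>UNIV. card (F i))"
  using bij_betw_same_card[OF bij_betw_vec_nth_box[of F]] by (simp add: card_PiE)

lemma finite_box:
  assumes "\<And>i. finite (F i)"
  shows "finite {x :: 'a ^ 'n::finite. \<forall>i. x $ i \<in> F i}"
  using bij_betw_finite[OF bij_betw_vec_nth_box[of F]] assms by (simp add: finite_PiE)

text \<open>The last clause records the minimality of \<open>k\<close>; it later bounds the side of
  the cube from above.\<close>

lemma obtain_hull_points_signed_basis:
  obtains k where
    "hull_points (subset_sums (signed_basis :: (int ^ 'n::finite) set)) n
      = {z. \<forall>i. z $ i \<in> {- int k..int k}}"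
    "n \<le> (2 * k + 1) ^ CARD('n)"
    "\<And>m. m < k \<Longrightarrow> (2 * m + 1) ^ CARD('n) < n"
proof
  let ?S = "subset_sums (signed_basis :: (int ^ 'n) set)"
  let ?k = "kappa ?S n"
  have card: "card (dilate_points ?S m) = (2 * m + 1) ^ CARD('n)" for m
  proof -
    have "card {- int m..int m} = 2 * m + 1" by simp
    then show ?thesis by (simp only: dilate_points_signed_basis card_box prod_constant)
  qed
  show "hull_points ?S n = {z. \<forall>i. z $ i \<in> {- int ?k..int ?k}}"
    by (simp add: hull_points_def dilate_points_signed_basis)
  \<comment> \<open>The dilate by \<open>n\<close> already has enough points, so
    \<open>LEAST\<close> ranges over a nonempty set.\<close>
  have "n \<le> (2 * n + 1) ^ 1" by simp
  also have "\<dots> \<le> (2 * n + 1) ^ CARD('n)"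
    by (rule power_increasing) (simp_all add: Suc_leI)
  finally have "card (dilate_points ?S n) \<ge> n" by (simp add: card)
  then have "card (dilate_points ?S ?k) \<ge> n"
    unfolding kappa_def by (rule LeastI)
  then show "n \<le> (2 * ?k + 1) ^ CARD('n)" by (simp add: card)
  show "(2 * m + 1) ^ CARD('n) < n" if "m < ?k" for m
    using not_less_Least[OF that[unfolded kappa_def]] by (simp add: card not_le)
qed

subsection \<open>Near-equality\<close>

text \<open>Normalised AM--GM, used both for the ratios of projection sizes to \<open>q\<close> and
  for square roots of such ratios.\<close>

lemma card_le_sum_if_prod_ge_1:
  fixes x :: "'a \<Rightarrow> real"
  assumes "finite S" "S \<noteq> {}" "\<And>i. i \<in> S \<Longrightarrow> x i \<ge> 0" "(\<Prod>i\<in>S. x i) \<ge> 1"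
  shows "card S \<le> (\<Sum>i\<in>S. x i)"
proof -
  have "card S > 0" using assms by (simp add: card_gt_0_iff)
  have "1 ^ card S \<le> ((\<Sum>i\<in>S. x i) / card S) ^ card S"
    using prod_le_mean_power[OF assms(1,2), of x] assms(3,4) by auto
  moreover have "0 \<le> (\<Sum>i\<in>S. x i) / card S" using assms(3) by (simp add: sum_nonneg)
  ultimately have "1 \<le> (\<Sum>i\<in>S. x i) / card S"
    using \<open>card S > 0\<close> by (metis power_mono_iff zero_le_one)
  then show ?thesis using \<open>card S > 0\<close> by (simp add: field_simps)
qed

text \<open>
The AM--GM bound applied to the square roots makes \<open>\<Sum> (\<surd>x\<^sub>i - 1)\<^sup>2\<close> at most the excess
\<open>\<Sum> x\<^sub>i - card S\<close>.
\<close>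

lemma component_ge_if_sum_le:
  fixes x :: "'a \<Rightarrow> real" and s :: real
  assumes S: "finite S" "i \<in> S" and x0: "\<And>i. i \<in> S \<Longrightarrow> x i \<ge> 0" and prod: "(\<Prod>i\<in>S. x i) \<ge> 1"
    and sum: "(\<Sum>i\<in>S. x i) \<le> card S * (1 + s\<^sup>2)" and s: "0 \<le> s" "card S * s \<le> 1"
  shows "1 - 2 * card S * s \<le> x i"
proof -
  define c where "c = real (card S)"
  have c: "c \<ge> 1"
    using S by (metis One_nat_def Suc_leI c_def card_gt_0_iff empty_iff of_nat_1 of_nat_mono)
  have "(\<Prod>i\<in>S. sqrt (x i)) = sqrt (\<Prod>i\<in>S. x i)"
    using S(1) by (induction S) (auto simp: real_sqrt_mult)
  then have "c \<le> (\<Sum>i\<in>S. sqrt (x i))"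
    using prod S x0 card_le_sum_if_prod_ge_1[of S "\<lambda>i. sqrt (x i)"] by (auto simp: c_def)
  have "(sqrt (x i) - 1)\<^sup>2 \<le> (\<Sum>i\<in>S. (sqrt (x i) - 1)\<^sup>2)"
    using S by (intro member_le_sum) auto
  also have "\<dots> = (\<Sum>i\<in>S. x i - 2 * sqrt (x i) + 1)"
    using x0 by (intro sum.cong refl) (simp add: power2_diff)
  also have "\<dots> = (\<Sum>i\<in>S. x i) - 2 * (\<Sum>i\<in>S. sqrt (x i)) + c"
    by (simp add: sum.distrib sum_subtractf c_def flip: sum_distrib_left)
  also have "\<dots> \<le> c * s\<^sup>2"
    using sum \<open>c \<le> _\<close> by (simp add: c_def algebra_simps)
  \<comment> \<open>Enlarging \<open>c\<close> to its square makes the bound a perfect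
    square.\<close>
  also have "\<dots> \<le> c\<^sup>2 * s\<^sup>2"
    using c by (intro mult_right_mono) (auto simp: power2_eq_square)
  finally have "\<bar>sqrt (x i) - 1\<bar> \<le> \<bar>c * s\<bar>"
    by (simp only: power_mult_distrib[symmetric] abs_le_square_iff)
  then have "1 - c * s \<le> sqrt (x i)" using s c by auto
  \<comment> \<open>Squaring needs \<open>0 \<le> 1 - c * s\<close>, which is the hypothesis
    \<open>card S * s \<le> 1\<close>.\<close>
  then have "(1 - c * s)\<^sup>2 \<le> (sqrt (x i))\<^sup>2"
    using s by (intro power_mono) (auto simp: c_def)
  also have "\<dots> = x i" using x0 S by simp
  finally have "1 - 2 * (c * s) + (c * s)\<^sup>2 \<le> x i" by (simp add: power2_diff)
  then have "1 - 2 * (c * s) \<le> x i" using zero_le_power2[of "c * s"] by linarith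
  then show ?thesis by (simp add: c_def mult.assoc)
qed

text \<open>Here and below, \<open>r = n\<^bsup>1/d\<^esup>\<close>, \<open>q = n\<^bsup>1-1/d\<^esup>\<close> and \<open>s = \<surd>\<epsilon>\<close>.\<close>

lemma obtain_interval_capturing:
  fixes A :: "(int ^ 'n::finite) set" and q r s :: real and i :: 'n
  assumes A: "finite A" and n: "card A = n" "n > 0" and d: "CARD('n) = d" "d \<ge> 2"
    and bd: "edge_boundary signed_basis A \<le> 2 * real d * q * (1 + s\<^sup>2)"
    and q: "q > 0" "q ^ d = real n ^ (d - 1)" "q * r = n"
    and s: "0 < s" "8 * real d * s \<le> 1"
  obtains a b where "card {a..b} \<le> r * (1 + 28 * real d * s)"
    "card {x \<in> A. x $ i \<notin> {a..b}} \<le> 13 * real d * s * n"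
proof -
  define B where "B j = real (card (forget j ` A))" for j
  define N where "N = B i"
  define u where "u = real d * s"
  have A0: "A \<noteq> {}" using n by auto
  have B0: "B j > 0" for j using A A0 by (simp add: B_def card_gt_0_iff)
  have u: "0 < u" "u \<le> 1/8" "s \<le> u" "2 * s \<le> u" using s d by (auto simp: u_def)
  have s16: "s \<le> 1/16" using u by simp
  have s2: "s\<^sup>2 \<le> s / 16" using s s16 by (simp add: power2_eq_square mult_left_mono mult.commute)
  have prodB: "real n ^ (d - 1) \<le> (\<Prod>j\<in>UNIV. B j)"
  proof -
    have "n ^ d \<le> n * (\<Prod>j\<in>UNIV. card (forget j ` A))"
      using Loomis_Whitney[of "UNIV :: 'n set" A] A n d by simp
    moreover have "n ^ d = n * n ^ (d - 1)" using d by (cases d) auto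
    ultimately have "n ^ (d - 1) \<le> (\<Prod>j\<in>UNIV. card (forget j ` A))" using n by simp
    then show ?thesis
      unfolding B_def by (simp only: of_nat_prod[symmetric] of_nat_power[symmetric] of_nat_le_iff)
  qed
  have prod_ratio: "(\<Prod>j\<in>UNIV. B j / q) \<ge> 1"
    using prodB q n d by (simp add: prod_dividef)
  have sum_ge: "real d * q \<le> (\<Sum>j\<in>UNIV. B j)"
    using card_le_sum_if_prod_ge_1[of "UNIV :: 'n set" "\<lambda>j. B j / q"] prod_ratio B0 q d
    by (simp add: less_imp_le field_simps flip: sum_divide_distrib)
  have "2 * (\<Sum>j\<in>UNIV. B j) + card (gappy A i) \<le> edge_boundary signed_basis A"
    using of_nat_mono[OF edge_boundary_ge[OF A, of i], where 'a = real] by (simp add: B_def)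
  then have bd2: "2 * (\<Sum>j\<in>UNIV. B j) + card (gappy A i) \<le> 2 * (real d * q) + 2 * (real d * q) * s\<^sup>2"
    using bd by (simp add: algebra_simps)
  then have sum_le: "(\<Sum>j\<in>UNIV. B j) \<le> real d * q * (1 + s\<^sup>2)"
    by (simp add: algebra_simps)
  have "(\<Sum>j\<in>UNIV. B j / q) \<le> d * (1 + s\<^sup>2)"
    using sum_le q by (simp add: field_simps flip: sum_divide_distrib)
  then have "1 - 2 * u \<le> B i / q"
    using component_ge_if_sum_le[of UNIV i "\<lambda>j. B j / q" s] prod_ratio B0 q d s
    by (simp add: less_imp_le u_def)
  then have Nq: "q * (1 - 2 * u) \<le> N" using q by (simp add: N_def field_simps)
  have "q * (3/4) \<le> q * (1 - 2 * u)" using u q by (intro mult_left_mono) auto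
  then have Nq': "q * (3/4) \<le> N" using Nq by linarith
  have N0: "N > 0" by (simp add: N_def B0)
  have gaps: "2 * card (gappy A i) \<le> card (forget i ` A)"
  proof -
    \<comment> \<open>The lower bound \<open>sum_ge\<close> uses up the main term of the boundary,
      so only the error term can pay for gappy lines.\<close>
    have "card (gappy A i) \<le> 2 * q * (d * s\<^sup>2)" using bd2 sum_ge by (simp add: algebra_simps)
    also have "d * s\<^sup>2 = u * s" by (simp add: u_def power2_eq_square)
    also have "2 * q * (u * s) \<le> 2 * q * (1/8 * (1/16))"
      using u s s16 q by (intro mult_left_mono mult_mono) auto
    finally have "real (2 * card (gappy A i)) \<le> N" using Nq' q by simp
    then show ?thesis by (simp only: N_def B_def of_nat_le_iff)
  qed
  define k where "k = d - 1"
  have k: "k > 0" "d = Suc k" using d by (auto simp: k_def)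
  define mout where "mout = real (card {x \<in> A. card (slice A i (x $ i)) < (1 - s) * N})"
  \<comment> \<open>With \<open>\<delta> = s\<close>, an excess of order
    \<open>n * s\<^sup>2\<close> is divided by the weight \<open>s / k\<close>, leaving order
    \<open>k * s * n\<close>.\<close>
  have mout: "mout \<le> 3 * u * n"
  proof -
    have I: "card (UNIV - {i}) = k" "insert i (UNIV - {i}) = UNIV" using d by (auto simp: k_def)
    then have "UNIV - {i} \<noteq> {}" using k by (metis card.empty less_irrefl)
    moreover have "card (slice A i t) ^ card (UNIV - {i})
        \<le> card (slice A i t) * (\<Prod>j\<in>UNIV - {i}. card (forget j ` slice A i t))" for t
      using \<open>UNIV - {i} \<noteq> {}\<close> A by (intro Loomis_Whitney) (auto simp: slice_def)
    ultimately have "n + s / k * mout \<le> root k (\<Prod>j\<in>UNIV. B j)"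
      using card_thin_slices_bound[of A "UNIV - {i}" i s] A A0 s s16 n I
      by (simp add: mout_def N_def B_def)
    also have "\<dots> \<le> root k ((real n * (1 + s\<^sup>2)\<^sup>2) ^ k)"
    proof -
      have "(\<Prod>j\<in>UNIV. B j) \<le> ((\<Sum>j\<in>UNIV. B j) / d) ^ d"
        using prod_le_mean_power[of "UNIV :: 'n set" B] B0 d by (simp add: less_imp_le)
      also have "\<dots> \<le> (q * (1 + s\<^sup>2)) ^ d"
        using sum_le d B0 by (intro power_mono divide_nonneg_nonneg sum_nonneg)
          (auto simp: field_simps less_imp_le)
      also have "\<dots> = real n ^ k * (1 + s\<^sup>2) ^ d" using q by (simp add: power_mult_distrib k_def)
      \<comment> \<open>The exponent \<open>d = k + 1\<close> is raised to \<open>2 * k\<close> so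
        that the \<open>k\<close>-th root can be taken exactly.\<close>
      also have "\<dots> \<le> real n ^ k * (1 + s\<^sup>2) ^ (2 * k)"
        using k by (intro mult_left_mono power_increasing) auto
      finally have "(\<Prod>j\<in>UNIV. B j) \<le> (real n * (1 + s\<^sup>2)\<^sup>2) ^ k"
        by (simp add: power_mult_distrib power_mult)
      then show ?thesis using k by simp
    qed
    also have "\<dots> = real n * (1 + s\<^sup>2)\<^sup>2" using k by (intro real_root_power_cancel) auto
    also have "\<dots> \<le> real n * (1 + 3 * s\<^sup>2)"
    proof -
      have "s\<^sup>2 * s\<^sup>2 \<le> 1 * s\<^sup>2" using s2 s16 by (intro mult_right_mono) auto
      then have "(1 + s\<^sup>2)\<^sup>2 \<le> 1 + 3 * s\<^sup>2" by (simp add: power2_eq_square[of "1 + _"] algebra_simps)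
      then show ?thesis by (intro mult_left_mono) auto
    qed
    finally have "s / k * mout \<le> 3 * n * s\<^sup>2" by (simp add: algebra_simps)
    then have "s * mout \<le> s * (3 * (k * s) * n)" using k by (simp add: field_simps power2_eq_square)
    then have "mout \<le> 3 * (k * s) * n" using s by simp
    also have "\<dots> \<le> 3 * u * n"
      using s k by (intro mult_right_mono mult_left_mono) (auto simp: u_def)
    finally show ?thesis .
  qed
  define T where "T = {t \<in> (\<lambda>x. x $ i) ` A. (1 - s) * N \<le> card (slice A i t)}"
  have finT: "finite T" using A by (simp add: T_def)
  have "{x \<in> A. x $ i \<notin> T} = {x \<in> A. card (slice A i (x $ i)) < (1 - s) * N}"
    by (auto simp: T_def)
  then have cT: "real (card {x \<in> A. x $ i \<notin> T}) = mout" by (simp add: mout_def)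
  \<comment> \<open>Each level in \<open>T\<close> carries at least \<open>(1 - s) * N\<close> of
    the \<open>n\<close> points, and \<open>1 / (1 - s) \<le> 1 + 2 * s\<close> for small
    \<open>s\<close>.\<close>
  have NT: "N * card T \<le> n * (1 + 2 * s)"
  proof -
    have "(\<Sum>t\<in>T. (1 - s) * N) \<le> (\<Sum>t\<in>T. real (card (slice A i t)))"
      by (intro sum_mono) (auto simp: T_def)
    also have "\<dots> \<le> (\<Sum>t\<in>(\<lambda>x. x $ i) ` A. real (card (slice A i t)))"
      using A by (intro sum_mono2) (auto simp: T_def)
    also have "\<dots> = n" using sum_over_slices[OF A, of "\<lambda>_. 1" i] n by simp
    finally have "(1 - s) * (N * card T) \<le> n" by (simp add: mult_ac)
    also have "real n * 1 \<le> n * ((1 - s) * (1 + 2 * s))"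
      using s2 s by (intro mult_left_mono) (auto simp: algebra_simps power2_eq_square)
    finally have "(1 - s) * (N * card T) \<le> (1 - s) * (n * (1 + 2 * s))" by (simp add: mult_ac)
    then show ?thesis using s16 by simp
  qed
  obtain a b where
    ab: "(card (T - {a..b}) + card ({a..b} - T)) * N \<le> 2 * (s * N * card T + mout)"
    using obtain_interval_fibre[OF A A0 finT _ gaps, of s] unfolding cT N_def B_def[symmetric]
    by (auto simp: T_def N_def B_def)
  have sNT: "s * N * card T \<le> s * (2 * n)"
  proof -
    have "n * (1 + 2 * s) \<le> real n * 2" using s16 by (intro mult_left_mono) auto
    then have "N * card T \<le> 2 * n" using NT by simp
    then show ?thesis using s by (simp add: mult.assoc mult_left_mono)
  qed
  also have "\<dots> \<le> u * n" using mult_right_mono[OF u(4), of "real n"] by (simp add: mult_ac)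
  finally have "(card (T - {a..b}) + card ({a..b} - T)) * N \<le> 2 * (u * n + 3 * u * n)"
    using ab mout by simp
  then have "card (T - {a..b}) * N + card ({a..b} - T) * N \<le> 8 * (u * n)"
    by (simp add: algebra_simps)
  also have "\<dots> \<le> 10 * u * n" using u by simp
  finally have c12: "card (T - {a..b}) * N + card ({a..b} - T) * N \<le> 10 * u * n" .
  then have c1: "card (T - {a..b}) * N \<le> 10 * u * n" and c2: "card ({a..b} - T) * N \<le> 10 * u * n"
    using N0 by (smt (verit) mult_nonneg_nonneg of_nat_0_le_iff)+
  show thesis
  proof (rule that)
    \<comment> \<open>The length is first bounded after multiplication by \<open>N\<close>, then
      \<open>N\<close> is replaced by its lower bound \<open>q * (1 - 2 * u)\<close>.\<close>
    have "{a..b} \<subseteq> T \<union> ({a..b} - T)" by auto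
    then have "card {a..b} \<le> card (T \<union> ({a..b} - T))" using finT by (intro card_mono) auto
    also have "\<dots> \<le> card T + card ({a..b} - T)" by (rule card_Un_le)
    finally have "real (card {a..b}) \<le> real (card T) + real (card ({a..b} - T))" by linarith
    then have "N * card {a..b} \<le> N * (real (card T) + real (card ({a..b} - T)))"
      using N0 by (intro mult_left_mono) auto
    also have "\<dots> = N * card T + card ({a..b} - T) * N" by (simp add: algebra_simps)
    also have "\<dots> \<le> n * (1 + 2 * s) + 10 * u * n" using NT c2 by simp
    also have "\<dots> \<le> n * (1 + 12 * u)"
      using mult_left_mono[OF u(3), of "real n"] by (simp add: algebra_simps)
    also have "\<dots> = q * (r * (1 + 12 * u))" using q by (simp flip: mult.assoc)
    finally have "N * card {a..b} \<le> q * (r * (1 + 12 * u))" .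
    moreover have "q * (1 - 2 * u) * card {a..b} \<le> N * card {a..b}"
      using Nq by (intro mult_right_mono) auto
    ultimately have "q * ((1 - 2 * u) * card {a..b}) \<le> q * (r * (1 + 12 * u))" by (simp add: mult_ac)
    then have "(1 - 2 * u) * card {a..b} \<le> r * (1 + 12 * u)" using q by simp
    also have "\<dots> \<le> r * ((1 - 2 * u) * (1 + 28 * u))"
    \<comment> \<open>The product is \<open>1 + 26 * u - 56 * u * u\<close>, and
      \<open>u \<le> 1/8\<close> makes this at least \<open>1 + 19 * u\<close>.\<close>
    proof (rule mult_left_mono)
      have "u * u \<le> u * (1/8)" using u by (intro mult_left_mono) auto
      then show "1 + 12 * u \<le> (1 - 2 * u) * (1 + 28 * u)" using u by (simp add: algebra_simps)
      show "0 \<le> r" using q by (metis of_nat_0_le_iff zero_le_mult_iff less_le_not_le)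
    qed
    finally have "(1 - 2 * u) * card {a..b} \<le> (1 - 2 * u) * (r * (1 + 28 * u))" by (simp add: mult_ac)
    then show "card {a..b} \<le> r * (1 + 28 * real d * s)" using u by (simp add: u_def mult.assoc)
  next
    \<comment> \<open>Lost points lie in thin slices (\<open>3 * u * n\<close>) or on levels of
      \<open>T\<close> outside the interval (\<open>10 * u * n\<close>), whence 13.\<close>
    have "{x \<in> A. x $ i \<notin> {a..b}} \<subseteq> {x \<in> A. x $ i \<notin> T} \<union> (\<Union>t\<in>T - {a..b}. slice A i t)"
      by (auto simp: slice_def)
    then have "card {x \<in> A. x $ i \<notin> {a..b}}
        \<le> card ({x \<in> A. x $ i \<notin> T} \<union> (\<Union>t\<in>T - {a..b}. slice A i t))"
      using A finT by (intro card_mono) auto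
    also have "\<dots> \<le> card {x \<in> A. x $ i \<notin> T} + card (\<Union>t\<in>T - {a..b}. slice A i t)"
      by (rule card_Un_le)
    also have "card (\<Union>t\<in>T - {a..b}. slice A i t) \<le> (\<Sum>t\<in>T - {a..b}. card (slice A i t))"
      using finT by (intro card_UN_le) auto
    also have "\<dots> \<le> (\<Sum>t\<in>T - {a..b}. card (forget i ` A))"
      by (intro sum_mono card_slice_le_forget A)
    finally have "real (card {x \<in> A. x $ i \<notin> {a..b}})
        \<le> real (card {x \<in> A. x $ i \<notin> T} + card (T - {a..b}) * card (forget i ` A))"
      by (simp only: of_nat_le_iff sum_constant of_nat_id)
    then have "card {x \<in> A. x $ i \<notin> {a..b}} \<le> mout + card (T - {a..b}) * N"
      by (simp add: cT N_def B_def)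
    also have "\<dots> \<le> 13 * u * n" using mout c1 by simp
    finally show "card {x \<in> A. x $ i \<notin> {a..b}} \<le> 13 * real d * s * n" by (simp add: u_def mult.assoc)
  qed
qed

section \<open>From intervals in all directions to one cube\<close>

text \<open>By convexity the power lies below its chord between \<open>x = 0\<close> and
  \<open>x = 1\<close>.\<close>

lemma power_one_plus_le:
  fixes x :: real
  assumes "0 \<le> x" "x \<le> 1"
  shows "(1 + x) ^ m \<le> 1 + (2 ^ m - 1) * x"
proof (induction m)
  case (Suc m)
  have "x * x \<le> x" using assms by (simp add: mult_left_le)
  have "(1 + x) ^ Suc m \<le> (1 + x) * (1 + (2 ^ m - 1) * x)"
    using Suc assms by (simp add: mult_left_mono)
  also have "\<dots> = 1 + 2 ^ m * x + (2 ^ m - 1) * (x * x)" by (simp add: algebra_simps)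
  also have "\<dots> \<le> 1 + 2 ^ m * x + (2 ^ m - 1) * x"
    using \<open>x * x \<le> x\<close> by (intro add_left_mono mult_left_mono) auto
  finally show ?case by (simp add: algebra_simps)
qed simp

text \<open>Both \<open>A\<close> and \<open>Q\<close> nearly fill the box \<open>J\<close>:
  \<open>card Q \<ge> card A\<close> limits \<open>J - Q\<close>, and \<open>J - A\<close> exceeds
  \<open>card J - card A\<close> only by \<open>A - J\<close>.\<close>

lemma card_sym_diff_le:
  assumes "finite A" "finite J" "Q \<subseteq> J" "card A \<le> card Q"
  shows "real (card (sym_diff A Q)) \<le> 2 * real (card (A - J)) + 2 * (real (card J) - real (card A))"
proof -
  have fin: "finite Q" using assms finite_subset by blast
  have "sym_diff A Q \<subseteq> (A - J) \<union> ((J - Q) \<union> (J - A))" using assms by auto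
  then have "card (sym_diff A Q) \<le> card ((A - J) \<union> ((J - Q) \<union> (J - A)))"
    using assms by (intro card_mono) auto
  also have "\<dots> \<le> card (A - J) + (card (J - Q) + card (J - A))"
    by (meson add_left_mono card_Un_le order_trans)
  finally have 1: "card (sym_diff A Q) \<le> card (A - J) + (card (J - Q) + card (J - A))" .
  have 2: "card J = card Q + card (J - Q)"
    using assms fin by (metis add.commute card_Diff_subset card_mono le_add_diff_inverse2)
  have 3: "card J = card (J \<inter> A) + card (J - A)" "card A = card (J \<inter> A) + card (A - J)"
    using assms by (metis add.commute card_Int_Diff Int_commute)+
  have "real s \<le> 2 * real a + 2 * (real j - real c)"
    if "s \<le> a + (b + e)" "j = q + b" "j = i + e" "c = i + a" "c \<le> q" for s a b c e i j q :: nat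
    using that by simp
  from this[OF 1 2 3 assms(4)] show ?thesis .
qed

text \<open>The intervals of all directions are extended to a common length \<open>M\<close>. The
  resulting box \<open>J\<close> holds most of \<open>A\<close> and a full translate of the target
  cube, and has little more than \<open>n\<close> points. The hypothesis
  \<open>1 \<le> s * r\<close> absorbs rounding.\<close>

lemma close_to_cube:
  fixes A :: "(int ^ 'n::finite) set" and q r s :: real
  assumes A: "finite A" and n: "card A = n" "n > 0" and d: "CARD('n) = d" "d \<ge> 2"
    and bd: "edge_boundary signed_basis A \<le> 2 * real d * q * (1 + s\<^sup>2)"
    and q: "q > 0" "q ^ d = real n ^ (d - 1)" "q * r = n" and r: "r > 0" "r ^ d = n" "1 \<le> s * r"
    and s: "0 < s" "31 * real d * s \<le> 1"
  shows "\<exists>v :: int ^ 'n. real (card (sym_diff A ((+) v ` hull_points (subset_sums signed_basis) n)))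
    < 1000 * real d ^ 2 * 2 ^ d * n * s"
proof -
  define u where "u = real d * s"
  have u: "0 < u" "31 * u \<le> 1" "s \<le> u" using s d by (auto simp: u_def)
  obtain k where Q: "hull_points (subset_sums (signed_basis :: (int ^ 'n) set)) n
      = {z. \<forall>i. z $ i \<in> {- int k..int k}}"
    and k1: "n \<le> (2 * k + 1) ^ d" and k2: "\<And>m. m < k \<Longrightarrow> (2 * m + 1) ^ d < n"
    using obtain_hull_points_signed_basis[where 'n = 'n and n = n] d by metis
  \<comment> \<open>The ceiling accommodates the intervals. The 2 accommodates the cube: minimality
    gives only \<open>2 * k - 1 < r\<close> for \<open>k > 0\<close>.\<close>
  define M where "M = nat \<lceil>r * (1 + 28 * u)\<rceil> + 2"
  have M1: "r * (1 + 28 * u) + 2 \<le> M" unfolding M_def by linarith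
  have r0: "0 \<le> r * (1 + 28 * u)" using r u by simp
  then have "M \<le> r * (1 + 28 * u) + 3" unfolding M_def by linarith
  also have "\<dots> \<le> r * (1 + 28 * u) + 3 * (r * u)"
  proof -
    have "s * r \<le> u * r" using u r by (intro mult_right_mono) auto
    then have "1 \<le> r * u" using r(3) by (simp add: mult.commute)
    then show ?thesis by linarith
  qed
  finally have M2: "M \<le> r * (1 + 31 * u)" by (simp add: algebra_simps)
  have kM: "2 * k + 1 \<le> M"
  proof (cases k)
    case (Suc m)
    have "real ((2 * m + 1) ^ d) < real n" using k2[of m] Suc by (simp only: of_nat_less_iff)
    then have "real (2 * m + 1) ^ d < r ^ d" using r by simp
    then have "real (2 * m + 1) < r" using r power_less_imp_less_base by (metis less_imp_le)
    moreover have "r \<le> r * (1 + 28 * u)" using r u by simp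
    ultimately have "real (2 * m + 1) + 2 < real M" using M1 by linarith
    then have "2 * m + 3 < M" by simp
    then show ?thesis using Suc by simp
  qed (simp add: M_def)
  have "\<forall>i. \<exists>a. card {x \<in> A. x $ i \<notin> {a..a + int M - 1}} \<le> 13 * u * n"
  proof
    fix i :: 'n
    have "8 * real d * s \<le> 1" using u by (simp add: u_def)
    from obtain_interval_capturing[OF A n d bd q s(1) this, of i] obtain a b
      where ab: "card {a..b} \<le> r * (1 + 28 * real d * s)"
        "card {x \<in> A. x $ i \<notin> {a..b}} \<le> 13 * real d * s * n" by blast
    then have "card {a..b} \<le> M" using M1 by (simp add: u_def mult.assoc)
    then have "b \<le> a + int M - 1" by simp
    then have "{x \<in> A. x $ i \<notin> {a..a + int M - 1}} \<subseteq> {x \<in> A. x $ i \<notin> {a..b}}" by auto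
    then have "card {x \<in> A. x $ i \<notin> {a..a + int M - 1}} \<le> card {x \<in> A. x $ i \<notin> {a..b}}"
      using A by (intro card_mono) auto
    then show "\<exists>a. card {x \<in> A. x $ i \<notin> {a..a + int M - 1}} \<le> 13 * u * n"
      using ab(2) by (intro exI[of _ a]) (simp add: u_def mult.assoc)
  qed
  from choice[OF this]
  obtain a where a: "\<And>i. card {x \<in> A. x $ i \<notin> {a i..a i + int M - 1}} \<le> 13 * u * n"
    by (elim exE) (rule that, erule spec)
  define J where "J = {x :: int ^ 'n. \<forall>i. x $ i \<in> {a i..a i + int M - 1}}"
  have cJ: "card J = M ^ d" unfolding J_def card_box using d by simp
  have fJ: "finite J" unfolding J_def by (rule finite_box) simp
  \<comment> \<open>With this centre the lower corners of the translated cube and of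
    \<open>J\<close> coincide.\<close>
  define v :: "int ^ 'n" where "v = (\<chi> i. a i + int k)"
  define V where "V = (+) v ` hull_points (subset_sums signed_basis) n"
  have "card V = (2 * k + 1) ^ d"
  proof -
    have "card {- int k..int k} = 2 * k + 1" by simp
    moreover have "card V = card {z :: int ^ 'n. \<forall>i. z $ i \<in> {- int k..int k}}"
      unfolding V_def Q by (rule card_image) simp
    ultimately show ?thesis using d by (simp only: card_box prod_constant)
  qed
  moreover have "V \<subseteq> J"
  proof
    fix x assume "x \<in> V"
    then obtain z where z: "x = v + z" "\<And>i. - int k \<le> z $ i \<and> z $ i \<le> int k"
      by (auto simp: V_def Q)
    have "a i \<le> x $ i \<and> x $ i \<le> a i + int M - 1" for i
      using z(2)[of i] kM by (simp add: z(1) v_def)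
    then show "x \<in> J" by (simp add: J_def)
  qed
  ultimately have sd: "card (sym_diff A V) \<le> 2 * real (card (A - J)) + 2 * (real M ^ d - n)"
    using card_sym_diff_le[OF A fJ, of V] k1 n cJ by simp
  have "A - J \<subseteq> (\<Union>i. {x \<in> A. x $ i \<notin> {a i..a i + int M - 1}})" by (auto simp: J_def)
  then have "card (A - J) \<le> card (\<Union>i. {x \<in> A. x $ i \<notin> {a i..a i + int M - 1}})"
    using A by (intro card_mono) auto
  also have "\<dots> \<le> (\<Sum>i\<in>UNIV. card {x \<in> A. x $ i \<notin> {a i..a i + int M - 1}})"
    by (rule card_UN_le) simp
  finally have "real (card (A - J)) \<le> (\<Sum>i\<in>UNIV. real (card {x \<in> A. x $ i \<notin> {a i..a i + int M - 1}}))"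
    by (simp only: of_nat_sum[symmetric] of_nat_le_iff)
  also have "\<dots> \<le> (\<Sum>i\<in>(UNIV :: 'n set). 13 * u * n)" by (intro sum_mono a)
  also have "\<dots> = 13 * (real d ^ 2 * (n * s))" using d by (simp add: u_def power2_eq_square)
  finally have AJ: "real (card (A - J)) \<le> 13 * (real d ^ 2 * (n * s))" .
  have "real M ^ d \<le> (r * (1 + 31 * u)) ^ d" using M2 by (intro power_mono) auto
  also have "\<dots> = n * (1 + 31 * u) ^ d" using r by (simp add: power_mult_distrib)
  also have "\<dots> \<le> n * (1 + (2 ^ d - 1) * (31 * u))"
    using u by (intro mult_left_mono power_one_plus_le) auto
  also have "\<dots> \<le> n * (1 + 2 ^ d * (31 * u))"
    using u by (intro mult_left_mono add_left_mono mult_right_mono) auto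
  finally have "real M ^ d - n \<le> 31 * (2 ^ d * real d * (n * s))" by (simp add: u_def algebra_simps)
  also have "\<dots> \<le> 31 * (2 ^ d * real d ^ 2 * (n * s))"
    using s d by (intro mult_left_mono mult_right_mono) (auto simp: power2_eq_square)
  finally have MJ: "real M ^ d - n \<le> 31 * (2 ^ d * real d ^ 2 * (n * s))" .
  have "1 * (real d ^ 2 * (n * s)) \<le> 2 ^ d * (real d ^ 2 * (n * s))"
    using s by (intro mult_right_mono) auto
  \<comment> \<open>Here \<open>88 = 2 * 13 + 2 * 31\<close>; the larger constant 1000 makes the
    final inequality strict.\<close>
  then have "card (sym_diff A V) \<le> 88 * (2 ^ d * real d ^ 2 * (n * s))"
    using sd AJ MJ by (simp add: mult.assoc)
  also have "\<dots> < 1000 * (2 ^ d * real d ^ 2 * (n * s))"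
    using s n d by simp
  finally show ?thesis unfolding V_def by (intro exI[of _ v]) (simp add: mult_ac)
qed

theorem theorem3p1:
  assumes "CARD('n::finite) \<ge> 2"
  shows "\<exists>K::nat. K \<ge> 1 \<and>
    (\<forall>(A :: (int ^ 'n) set) (n :: nat) (\<epsilon> :: real).
      finite A \<longrightarrow> card A = n \<longrightarrow> n \<ge> K \<longrightarrow>
      real K * real n powr (- 1 / (2 * real CARD('n))) < \<epsilon> \<longrightarrow> \<epsilon> < 1 / real K \<longrightarrow>
      real (edge_boundary signed_basis A)
        \<le> 2 * real CARD('n) * real n powr (1 - 1 / real CARD('n)) * (1 + \<epsilon>) \<longrightarrow>
      (\<exists>v :: int ^ 'n.
        real (card (sym_diff A ((+) v ` hull_points (subset_sums signed_basis) n)))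
          < real K * real n * sqrt \<epsilon>))"
proof -
  define d where "d = CARD('n)"
  define K :: nat where "K = 1000 * d ^ 2 * 2 ^ d"
  have d: "d \<ge> 2" using assms by (simp add: d_def)
  have K1: "K \<ge> 1" using d by (simp add: K_def Suc_leI)
  show ?thesis
  proof (rule exI[of _ K], intro conjI allI impI)
    fix A :: "(int ^ 'n) set" and n :: nat and \<epsilon> :: real
    assume A: "finite A" "card A = n" and "n \<ge> K"
      and lo: "real K * real n powr (- 1 / (2 * real CARD('n))) < \<epsilon>" and hi: "\<epsilon> < 1 / real K"
      and bd: "real (edge_boundary signed_basis A)
        \<le> 2 * real CARD('n) * real n powr (1 - 1 / real CARD('n)) * (1 + \<epsilon>)"
    define q where "q = real n powr (1 - 1 / d)"
    define r where "r = real n powr (1 / d)"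
    define s where "s = sqrt \<epsilon>"
    have n: "n \<ge> 1" using \<open>n \<ge> K\<close> K1 by simp
    have r0: "r \<ge> 1" using n by (simp add: r_def ge_one_powr_ge_zero)
    have \<epsilon>0: "\<epsilon> > 0" by (rule le_less_trans[OF _ lo]) simp
    have s: "s > 0" "s\<^sup>2 = \<epsilon>" using \<epsilon>0 by (auto simp: s_def)
    \<comment> \<open>As \<open>d \<ge> 2\<close>, the factor \<open>2 ^ d\<close> is at least 4.
      Then \<open>\<epsilon> < 1 / K\<close> yields \<open>31 * d * s \<le> 1\<close>, since
      \<open>31 * 31 = 961 < 4000\<close>.\<close>
    have Kd: "4000 * real d ^ 2 \<le> K"
    proof -
      have "(2::real) ^ 2 \<le> 2 ^ d" using d by (intro power_increasing) auto
      then have "1000 * real d ^ 2 * 4 \<le> 1000 * real d ^ 2 * 2 ^ d" by (intro mult_left_mono) auto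
      then show ?thesis by (simp add: K_def)
    qed
    have "\<epsilon> * K < 1" using hi K1 by (simp add: field_simps)
    moreover have "\<epsilon> * (4000 * real d ^ 2) \<le> \<epsilon> * K" using Kd \<epsilon>0 by (intro mult_left_mono) auto
    ultimately have "\<epsilon> * (4000 * real d ^ 2) < 1" by (rule le_less_trans[rotated])
    then have "4000 * (real d ^ 2 * \<epsilon>) < 1" by (simp only: mult_ac)
    moreover have "0 \<le> real d ^ 2 * \<epsilon>" using \<epsilon>0 by simp
    ultimately have "961 * (real d ^ 2 * \<epsilon>) \<le> 1" by linarith
    then have "(31 * real d * s)\<^sup>2 \<le> 1\<^sup>2"
      using s by (simp add: power_mult_distrib)
    then have sd: "31 * real d * s \<le> 1" by (rule power2_le_imp_le) simp
    have "s * 1 \<le> s * (31 * real d)" using s d by (intro mult_left_mono) auto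
    then have s1: "s \<le> 1" using sd by (simp add: mult_ac)
    \<comment> \<open>With \<open>p\<close> as below, \<open>p * p\<close> is the inverse of
      \<open>r\<close>, while \<open>p \<le> \<epsilon> \<le> s \<le> 1\<close> gives
      \<open>p * p \<le> s\<close>.\<close>
    have "1 \<le> s * r"
    proof -
      define p where "p = real n powr (- 1 / (2 * real d))"
      have p0: "p > 0" using n by (simp add: p_def)
      have "p * p * r = real n powr 0"
        unfolding p_def r_def powr_add[symmetric] using d by (simp add: field_simps)
      then have pr: "p * p * r = 1" using n by simp
      have "1 * p \<le> K * p" using K1 p0 by (intro mult_right_mono) auto
      then have "p \<le> \<epsilon>" using lo by (simp add: p_def d_def)
      also have "\<epsilon> \<le> s" using s s1 by (simp add: power2_eq_square flip: s(2))
      finally have "p \<le> s" .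
      moreover have "p * p \<le> p * 1" using \<open>p \<le> s\<close> s1 p0 by (intro mult_left_mono) auto
      ultimately have "p * p * r \<le> s * r" using r0 by (intro mult_right_mono) auto
      then show ?thesis using pr by simp
    qed
    moreover have "q ^ d = real n ^ (d - 1)"
    proof -
      have "q ^ d = real n powr (real d * (1 - 1 / d))"
        unfolding q_def using n by (subst powr_power) auto
      also have "real d * (1 - 1 / d) = real (d - 1)" using d by (simp add: field_simps of_nat_diff)
      finally show ?thesis using n by (simp add: powr_realpow)
    qed
    moreover have "r ^ d = n" unfolding r_def using n d by (subst powr_power) auto
    moreover have "q * r = n" unfolding q_def r_def powr_add[symmetric] using n by simp
    moreover have "edge_boundary signed_basis A \<le> 2 * real d * q * (1 + s\<^sup>2)"
      using bd by (simp add: d_def q_def s)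
    moreover have "q > 0" using n by (simp add: q_def)
    ultimately have "\<exists>v :: int ^ 'n. real (card (sym_diff A ((+) v ` hull_points (subset_sums signed_basis) n)))
        < 1000 * real d ^ 2 * 2 ^ d * n * s"
      using A n d r0 s(1) sd by (intro close_to_cube) (auto simp: d_def)
    then show "\<exists>v :: int ^ 'n. real (card (sym_diff A ((+) v ` hull_points (subset_sums signed_basis) n)))
        < real K * real n * sqrt \<epsilon>"
      by (simp add: K_def s_def)
  qed (rule K1)
qed

end
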